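(* Let $S$ be a numerical semigroup with multiplicity $m$ and depth $d$. If $d\notin\{1,2\}$ and $$|S\cap(m,2m)|\ge\sqrt{\frac{dm}{d-2}},$$ then $S$ satisfies Wilf's conjecture. Moreover, (for any depth $d$) if $|S\cap(m,2m)|\ge\sqrt{2m}$ then $S$ satisfies Wilf's conjecture.
   Context: $\mathbb{N}$ is the set of nonnegative integers. A numerical semigroup is a subset $S\subseteq\mathbb{N}$ that contains $0$, is closed under addition, and has finite complement in $\mathbb{N}$. Every numerical semigroup $S$ has a unique minimal generating set, which is finite; it is denoted $P(S)$. The multiplicity of $S$ is $\min P(S)$ (equivalently, the least positive element of $S$). For $S\neq\mathbb{N}$ the Frobenius number $F(S)$ is the largest element of $\mathbb{N}\setminus S$; by convention $F(\mathbb{N})=-1$. The depth of $S$ is $\lceil (F(S)+1)/m\rceil$, where $m$ is the multiplicity of $S$. The set of left elements of $S$ is $L(S)=\{s\in S: s<F(S)\}$. One says that $S$ satisfies Wilf's conjecture if $|P(S)|\cdot|L(S)|\ge F(S)+1$. $(m,2m)$ denotes the set of integers strictly between $m$ and $2m$. *)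

theory Defs
  imports Complex_Main
begin

definition numerical_semigroup :: "nat set \<Rightarrow> bool" where
  "numerical_semigroup S \<longleftrightarrow>
     0 \<in> S \<and> (\<forall>x\<in>S. \<forall>y\<in>S. x + y \<in> S) \<and> finite (UNIV - S)"

inductive_set submonoid_gen :: "nat set \<Rightarrow> nat set" for A :: "nat set" where
  zero: "0 \<in> submonoid_gen A"
| base: "a \<in> A \<Longrightarrow> a \<in> submonoid_gen A"
| add: "x \<in> submonoid_gen A \<Longrightarrow> y \<in> submonoid_gen A \<Longrightarrow> x + y \<in> submonoid_gen A"

definition minimal_generating_set :: "nat set \<Rightarrow> nat set \<Rightarrow> bool" where
  "minimal_generating_set S A \<longleftrightarrow>
     submonoid_gen A = S \<and> (\<forall>B. B \<subset> A \<longrightarrow> submonoid_gen B \<noteq> S)"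

text \<open>Existence, uniqueness and finiteness of the minimal generating set of a numerical
  semigroup are proved below.\<close>

definition min_generators :: "nat set \<Rightarrow> nat set" where
  "min_generators S = (THE A. minimal_generating_set S A)"

definition semigroup_multiplicity :: "nat set \<Rightarrow> nat" where
  "semigroup_multiplicity S = Min (min_generators S)"

definition frobenius_number :: "nat set \<Rightarrow> int" where
  "frobenius_number S = (if S = UNIV then -1 else int (Max (UNIV - S)))"

definition semigroup_depth :: "nat set \<Rightarrow> int" where
  "semigroup_depth S =
     \<lceil>(real_of_int (frobenius_number S) + 1) / real (semigroup_multiplicity S)\<rceil>"

definition left_elements :: "nat set \<Rightarrow> nat set" where
  "left_elements S = {s \<in> S. int s < frobenius_number S}"

definition satisfies_wilf :: "nat set \<Rightarrow> bool" where
  "satisfies_wilf S \<longleftrightarrow>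
     int (card (min_generators S) * card (left_elements S)) \<ge> frobenius_number S + 1"

definition semigroup_atoms :: "nat set \<Rightarrow> nat set" where
  "semigroup_atoms S =
     {s \<in> S. s \<noteq> 0 \<and> \<not> (\<exists>x\<in>S. \<exists>y\<in>S. x \<noteq> 0 \<and> y \<noteq> 0 \<and> s = x + y)}"

lemma add_notin_atoms:
  assumes "x \<in> S" "y \<in> S" "x \<noteq> 0" "y \<noteq> 0"
  shows "x + y \<notin> semigroup_atoms S"
proof
  assume "x + y \<in> semigroup_atoms S"
  then have "\<forall>u\<in>S. \<forall>v\<in>S. \<not> (u \<noteq> 0 \<and> v \<noteq> 0 \<and> x + y = u + v)"
    unfolding semigroup_atoms_def by simp
  from bspec[OF bspec[OF this assms(1)] assms(2)] assms(3,4) show False by simp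
qed

lemma submonoid_gen_least:
  assumes "A \<subseteq> S" "0 \<in> S" "\<forall>x\<in>S. \<forall>y\<in>S. x + y \<in> S"
  shows "submonoid_gen A \<subseteq> S"
proof
  fix x assume "x \<in> submonoid_gen A"
  then show "x \<in> S" by induction (use assms in auto)
qed

lemma atoms_subset_generating:
  assumes "submonoid_gen A = S"
  shows "semigroup_atoms S \<subseteq> A"
proof
  fix s assume s: "s \<in> semigroup_atoms S"
  then have "s \<in> submonoid_gen A" using assms by (auto simp: semigroup_atoms_def)
  then show "s \<in> A" using s
  proof induction
    case zero
    then show ?case by (simp add: semigroup_atoms_def)
  next
    case (base a)
    then show ?case by simp
  next
    case (add x y)
    then have "x \<in> S" "y \<in> S" using assms by auto
    with add.prems have "x = 0 \<or> y = 0" unfolding semigroup_atoms_def by blast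
    with add show ?case by auto
  qed
qed

lemma atoms_generate:
  assumes "numerical_semigroup S"
  shows "submonoid_gen (semigroup_atoms S) = S"
proof
  show "submonoid_gen (semigroup_atoms S) \<subseteq> S"
    by (rule submonoid_gen_least) (use assms in \<open>auto simp: numerical_semigroup_def semigroup_atoms_def\<close>)
  have "s \<in> S \<longrightarrow> s \<in> submonoid_gen (semigroup_atoms S)" for s
  proof (induction s rule: less_induct)
    case (less s)
    show ?case
    proof (cases "s = 0 \<or> s \<in> semigroup_atoms S")
      case True
      then show ?thesis by (auto intro: submonoid_gen.zero submonoid_gen.base)
    next
      case False
      show ?thesis
      proof
        assume "s \<in> S"
        with False obtain x y where "x \<in> S" "y \<in> S" "x \<noteq> 0" "y \<noteq> 0" "s = x + y"
          by (auto simp: semigroup_atoms_def)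
        then show "s \<in> submonoid_gen (semigroup_atoms S)"
          using less[of x] less[of y] by (auto intro: submonoid_gen.add)
      qed
    qed
  qed
  then show "S \<subseteq> submonoid_gen (semigroup_atoms S)" by blast
qed

lemma minimal_generating_set_iff:
  assumes "numerical_semigroup S"
  shows "minimal_generating_set S A \<longleftrightarrow> A = semigroup_atoms S"
proof
  assume A: "minimal_generating_set S A"
  have gen: "submonoid_gen A = S"
    using A unfolding minimal_generating_set_def by (rule conjunct1)
  have min: "submonoid_gen B \<noteq> S" if "B \<subset> A" for B
    using A that unfolding minimal_generating_set_def by simp
  show "A = semigroup_atoms S"
  proof (rule ccontr)
    assume "A \<noteq> semigroup_atoms S"
    with atoms_subset_generating[OF gen] have "semigroup_atoms S \<subset> A" by auto
    from min[OF this] atoms_generate[OF assms] show False by (rule notE)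
  qed
next
  assume A: "A = semigroup_atoms S"
  have "submonoid_gen B \<noteq> S" if B: "B \<subset> semigroup_atoms S" for B
  proof
    assume "submonoid_gen B = S"
    from atoms_subset_generating[OF this] B show False by (simp add: less_le_not_le)
  qed
  then show "minimal_generating_set S A"
    unfolding minimal_generating_set_def A using atoms_generate[OF assms] by simp
qed

lemma ex1_minimal_generating_set:
  assumes "numerical_semigroup S"
  shows "\<exists>!A. minimal_generating_set S A"
  using minimal_generating_set_iff[OF assms] by simp

lemma min_generators_eq_atoms:
  assumes "numerical_semigroup S"
  shows "min_generators S = semigroup_atoms S"
  unfolding min_generators_def minimal_generating_set_iff[OF assms] by simp

lemma eventually_mem:
  assumes "numerical_semigroup S"
  shows "\<exists>N. \<forall>n\<ge>N. n \<in> S"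
proof -
  have "finite (UNIV - S)" using assms by (simp add: numerical_semigroup_def)
  then obtain N where N: "\<forall>n\<in>UNIV - S. n < N" unfolding finite_nat_set_iff_bounded by blast
  have "n \<in> S" if "n \<ge> N" for n
  proof (rule ccontr)
    assume "n \<notin> S"
    then have "n < N" using N by simp
    then show False using that by simp
  qed
  then show ?thesis by blast
qed

lemma finite_min_generators:
  assumes S: "numerical_semigroup S"
  shows "finite (min_generators S)"
proof -
  obtain N where N: "\<And>n. n \<ge> N \<Longrightarrow> n \<in> S"
    using eventually_mem[OF S] by blast
  have "s < 2 * N + 2" if "s \<in> semigroup_atoms S" for s
  proof (rule ccontr)
    assume "\<not> s < 2 * N + 2"
    then have "2 * N + 2 \<le> s" by simp
    then obtain k where "s = 2 * N + 2 + k" unfolding le_iff_add by (elim exE)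
    then have k: "s = (N + 1) + (N + 1 + k)" by simp
    have "N + 1 \<in> S" "N + 1 + k \<in> S" "N + 1 \<noteq> 0" "N + 1 + k \<noteq> 0" using N by auto
    then have "s \<notin> semigroup_atoms S" unfolding k by (rule add_notin_atoms)
    with that show False by (rule notE[rotated])
  qed
  then show ?thesis
    unfolding min_generators_eq_atoms[OF S] finite_nat_set_iff_bounded by blast
qed

lemma semigroup_multiplicity_eq_Least:
  assumes S: "numerical_semigroup S"
  shows "semigroup_multiplicity S = (LEAST n. n \<in> S \<and> n > 0)"
proof -
  let ?m = "LEAST n. n \<in> S \<and> n > 0"
  obtain N where N: "\<And>n. n \<ge> N \<Longrightarrow> n \<in> S"
    using eventually_mem[OF S] by blast
  have ex: "\<exists>n. n \<in> S \<and> n > 0" using N[of "Suc N"] by auto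
  have m: "?m \<in> S \<and> ?m > 0" using LeastI_ex[OF ex] .
  have le: "?m \<le> n" if "n \<in> S" "n > 0" for n using that by (intro Least_le) auto
  have "?m \<in> semigroup_atoms S"
  proof -
    have False if "x \<in> S" "y \<in> S" "x \<noteq> 0" "y \<noteq> 0" "?m = x + y" for x y
      using le[of x] that by linarith
    then show ?thesis using m unfolding semigroup_atoms_def by auto
  qed
  moreover have "?m \<le> n" if "n \<in> semigroup_atoms S" for n
    using that le by (auto simp: semigroup_atoms_def)
  ultimately show ?thesis
    unfolding semigroup_multiplicity_def
    using finite_min_generators[OF S] min_generators_eq_atoms[OF S] by (intro Min_eqI) auto
qed

end

(* For a semigroup of multiplicity m and Frobenius number F, let K be the number of elements in
   [m, 2m); all of them are atoms.  Translating by multiples of m gives |L| >= 1 + (d - 2) K, so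
   |P| |L| >= (d - 2) K^2, which settles depth d >= 3 under the first bound and d >= 4 under the
   second.  In the remaining depths 2 and 3 one looks at a window of consecutive integers just
   above F: it lies in S, and a decomposable element of it is a sum of few left elements, so
   either |L| is large or the window supplies many further atoms. *)
theory Submission
  imports Defs
begin

text \<open>Sums correspond to unordered pairs: a new element z adds at most its sums with itself
  and with the earlier elements.\<close>

lemma card_sumset_le:
  fixes X :: "nat set"
  assumes "finite X"
  shows "2 * card {x + y |x y. x \<in> X \<and> y \<in> X} \<le> card X * (card X + 1)"
  using assms
proof (induction X rule: finite_induct)
  case empty
  then show ?case by simp
next
  case (insert z X)
  let ?T = "\<lambda>X. {x + y |x y. x \<in> X \<and> y \<in> X}"
  have fin: "finite (?T X)"
    using insert.hyps by (intro finite_image_set2) simp_all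
  have "?T (insert z X) \<subseteq> ?T X \<union> (+) z ` insert z X"
    by (auto simp: image_iff add.commute)
  then have "card (?T (insert z X)) \<le> card (?T X \<union> (+) z ` insert z X)"
    using fin insert.hyps by (intro card_mono) auto
  also have "\<dots> \<le> card (?T X) + card ((+) z ` insert z X)"
    by (rule card_Un_le)
  also have "card ((+) z ` insert z X) \<le> card X + 1"
    using card_image_le[of "insert z X" "(+) z"] insert.hyps by simp
  finally show ?case using insert by (simp add: algebra_simps)
qed

section \<open>Semigroups with a gap: atoms, left elements and decompositions\<close>

locale proper_numerical_semigroup =
  fixes S :: "nat set" and m F :: nat
  assumes semigroup: "numerical_semigroup S"
    and proper: "S \<noteq> UNIV"
    and m_def: "m = semigroup_multiplicity S"
    and F_def: "F = Max (UNIV - S)"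
begin

definition P :: "nat set" where "P = semigroup_atoms S"

definition L :: "nat set" where "L = {s \<in> S. s < F}"

lemma zero_in: "0 \<in> S"
  and add_in: "x \<in> S \<Longrightarrow> y \<in> S \<Longrightarrow> x + y \<in> S"
  and finite_gaps: "finite (UNIV - S)"
  using semigroup by (auto simp: numerical_semigroup_def)

lemma F_notin: "F \<notin> S"
  using Max_in[OF finite_gaps] proper unfolding F_def by auto

lemma above_F: "F < n \<Longrightarrow> n \<in> S"
  using Max_ge[OF finite_gaps, of n] unfolding F_def by auto

lemma m_in: "m \<in> S" and m_pos: "0 < m"
proof -
  have "\<exists>n. n \<in> S \<and> n > 0" using above_F[of "Suc F"] by auto
  from LeastI_ex[OF this] show "m \<in> S" "0 < m"
    unfolding m_def semigroup_multiplicity_eq_Least[OF semigroup] by auto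
qed

lemma m_le: "s \<in> S \<Longrightarrow> s \<noteq> 0 \<Longrightarrow> m \<le> s"
  unfolding m_def semigroup_multiplicity_eq_Least[OF semigroup] by (intro Least_le) auto

lemma mult_in: "j * m \<in> S"
  by (induction j) (auto simp: zero_in add_in m_in)

lemma F_pos: "0 < F"
  using F_notin zero_in by (cases F) auto

lemma finite_P [simp]: "finite P"
  using finite_min_generators[OF semigroup] min_generators_eq_atoms[OF semigroup]
  unfolding P_def by simp

lemma finite_L [simp]: "finite L"
  unfolding L_def by simp

lemma wilfI: "F + 1 \<le> card P * card L \<Longrightarrow> satisfies_wilf S"
  unfolding satisfies_wilf_def min_generators_eq_atoms[OF semigroup] left_elements_def
    frobenius_number_def P_def L_def F_def[symmetric]
  using proper F_def by (simp flip: of_nat_mult)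

text \<open>Ordering the summands bounds x by w/2, and \<open>m \<le> x\<close> bounds y by w - m;
  these two bounds locate the summands of window elements.\<close>

lemma decompose:
  assumes "w \<in> S" "w \<notin> P" "w \<noteq> 0"
  obtains x y where "x \<in> S" "y \<in> S" "m \<le> x" "x \<le> y" "w = x + y"
proof -
  obtain x y where xy: "x \<in> S" "y \<in> S" "x \<noteq> 0" "y \<noteq> 0" "w = x + y"
    using assms unfolding P_def semigroup_atoms_def by auto
  show thesis
  proof (cases "x \<le> y")
    case True
    then show thesis using that[of x y] xy m_le by auto
  next
    case False
    then show thesis using that[of y x] xy m_le by auto
  qed
qed

section \<open>The interval [m, 2m) and its translates\<close>

lemma first_interval_atoms: "S \<inter> {m..<2 * m} \<subseteq> P"
proof
  fix w assume w: "w \<in> S \<inter> {m..<2 * m}"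
  show "w \<in> P"
  proof (rule ccontr)
    assume "w \<notin> P"
    then have "w \<in> S" "w \<notin> P" "w \<noteq> 0" using w m_pos by auto
    then obtain x y where "x \<in> S" "y \<in> S" "m \<le> x" "x \<le> y" "w = x + y"
      by (rule decompose)
    then show False using w by auto
  qed
qed

lemma card_first_interval:
  "card (S \<inter> {m..<2 * m}) = card (S \<inter> {m<..<2 * m}) + 1"
proof -
  have "S \<inter> {m..<2 * m} = insert m (S \<inter> {m<..<2 * m})"
    using m_in m_pos by auto
  then show ?thesis by simp
qed

text \<open>The translates of \<open>S \<inter> {m..<2 * m}\<close> by j m with j < n lie in the
  disjoint intervals [(j + 1) m, (j + 2) m), all below (n + 1) m. The extra 1 counts 0.\<close>

lemma card_L_ge:
  assumes "(n + 1) * m \<le> F"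
  shows "1 + n * card (S \<inter> {m..<2 * m}) \<le> card L"
proof -
  let ?K = "S \<inter> {m..<2 * m}"
  let ?f = "\<lambda>(j, s). j * m + s"
  have inj: "inj_on ?f ({..<n} \<times> ?K)"
  proof (rule inj_onI, clarify)
    fix i s j t
    assume st: "s \<in> S" "t \<in> S" "s \<in> {m..<2 * m}" "t \<in> {m..<2 * m}"
      and eq: "i * m + s = j * m + t"
    \<comment> \<open>The quotient by m recovers which translate an element came from.\<close>
    have one: "(l * m + u) div m = l + 1" if "u \<in> {m..<2 * m}" for l u
    proof -
      have "u div m = 1" using that m_pos by (intro div_nat_eqI) auto
      then show ?thesis using m_pos by simp
    qed
    have "i = j" using one[OF st(3), of i] one[OF st(4), of j] eq by simp
    then show "i = j \<and> s = t" using eq by simp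
  qed
  have "?f ` ({..<n} \<times> ?K) \<subseteq> L - {0}"
  proof (rule image_subsetI)
    fix p assume "p \<in> {..<n} \<times> ?K"
    then obtain j s where p: "p = (j, s)" and j: "j < n" and s: "s \<in> S" "s \<in> {m..<2 * m}"
      by auto
    have "j * m + s < (j + 2) * m" using s by simp
    also have "\<dots> \<le> (n + 1) * m" using j by (intro mult_right_mono) auto
    finally have "j * m + s < F" using assms by simp
    then show "?f p \<in> L - {0}"
      using p s m_pos by (auto simp: L_def add_in mult_in)
  qed
  from card_mono[OF _ this] have "n * card ?K \<le> card (L - {0})"
    by (simp add: card_image[OF inj] card_cartesian_product)
  moreover have "0 \<in> L" using zero_in F_pos by (simp add: L_def)
  ultimately show ?thesis using card_Suc_Diff1[of L 0] by simp
qed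

text \<open>Here n is the depth minus 2. With k the size of the open interval, |P| >= k + 1 and |L|
  >= n k, so n k^2 bounds the product from below.\<close>

lemma wilf_from_first_interval:
  assumes "(n + 1) * m \<le> F" "F < (n + 2) * m"
    and "(n + 2) * m \<le> n * (card (S \<inter> {m<..<2 * m}))\<^sup>2"
  shows "satisfies_wilf S"
proof (rule wilfI)
  let ?k = "card (S \<inter> {m<..<2 * m})"
  have "?k + 1 \<le> card P"
    using card_mono[OF finite_P first_interval_atoms] card_first_interval by simp
  moreover have "n * ?k \<le> card L"
    using card_L_ge[OF assms(1)] card_first_interval by simp
  ultimately have "?k * (n * ?k) \<le> card P * card L"
    by (intro mult_mono) auto
  moreover have "?k * (n * ?k) = n * ?k\<^sup>2" by (simp add: power2_eq_square)
  ultimately show "F + 1 \<le> card P * card L" using assms by linarith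
qed

section \<open>Depths 1, 2 and 3\<close>

lemma wilf_depth_1:
  assumes "F < m"
  shows "satisfies_wilf S"
proof (rule wilfI)
  have "{m..<2 * m} \<subseteq> P"
    using first_interval_atoms above_F assms by fastforce
  from card_mono[OF finite_P this] have "m \<le> card P" by simp
  moreover have "0 \<in> L" using zero_in F_pos by (simp add: L_def)
  then have "1 \<le> card L" using card_gt_0_iff[of L] by force
  ultimately have "m * 1 \<le> card P * card L" by (rule mult_le_mono)
  then show "F + 1 \<le> card P * card L" using assms by simp
qed

text \<open>Elements of W outside U are atoms, and none of them is in A. The additive form avoids
  truncated subtraction.\<close>

lemma card_window_atoms:
  assumes "finite W" "finite U" "W - P \<subseteq> U" "A \<subseteq> P" "A \<inter> W = {}"
  shows "card A + card W \<le> card P + card U"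
proof -
  have "card W \<le> card (W \<inter> P) + card (W - P)"
    using card_Int_Diff[OF assms(1), of P] by simp
  moreover have "card (W - P) \<le> card U" using assms by (intro card_mono)
  moreover have "card A + card (W \<inter> P) = card (A \<union> (W \<inter> P))"
    using assms finite_subset[OF assms(4)] by (intro card_Un_disjoint[symmetric]) auto
  moreover have "card (A \<union> (W \<inter> P)) \<le> card P" using assms by (intro card_mono) auto
  ultimately show ?thesis by linarith
qed

text \<open>Put x = |X| and let q count the atoms outside X. Decomposable window elements are sums
  of two elements of X, so m <= q + x(x + 1)/2. As x >= 1, doubling gives 2m <= (q + x)(x + 1),
  while |L| >= x + 1.\<close>

lemma wilf_depth_2:
  assumes "m \<le> F" "F < 2 * m"
  shows "satisfies_wilf S"
proof (rule wilfI)
  define X where "X = S \<inter> {m..<F}"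
  define U where "U = {x + y |x y. x \<in> X \<and> y \<in> X}"
  let ?W = "{F<..F + m}"
  have fin: "finite X" by (simp add: X_def)
  then have finU: "finite U" unfolding U_def by (intro finite_image_set2) simp_all
  have "?W - P \<subseteq> U"
  proof
    fix w assume w: "w \<in> ?W - P"
    then have "w \<in> S" "w \<notin> P" "w \<noteq> 0" using above_F by auto
    then obtain x y where xy: "x \<in> S" "y \<in> S" "m \<le> x" "x \<le> y" "w = x + y"
      by (rule decompose)
    \<comment> \<open>Size alone gives only y <= w - m <= F; equality is excluded because F is a
      gap.\<close>
    moreover have "y \<noteq> F" using xy F_notin by auto
    ultimately have "x \<in> X" "y \<in> X" using w by (auto simp: X_def)
    then show "w \<in> U" using xy unfolding U_def by auto
  qed
  moreover have XP: "X \<subseteq> P" using first_interval_atoms assms by (auto simp: X_def)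
  moreover have "X \<inter> ?W = {}" by (auto simp: X_def)
  ultimately have window: "card X + m \<le> card P + card U"
    using card_window_atoms[of ?W U X] finU by simp
  have XL: "card X + 1 \<le> card L"
  proof -
    have "insert 0 X \<subseteq> L" using zero_in F_pos by (auto simp: X_def L_def)
    from card_mono[OF finite_L this] show ?thesis
      using fin m_pos by (simp add: X_def)
  qed
  have "m \<noteq> F" using m_in F_notin by auto
  then have "m \<in> X" using m_in assms by (simp add: X_def)
  then have pos: "1 \<le> card X" using fin card_gt_0_iff[of X] by force
  have U: "2 * card U \<le> card X * (card X + 1)"
    unfolding U_def by (rule card_sumset_le[OF fin])
  have P: "card X \<le> card P" using XP by (simp add: card_mono)
  have "2 * m \<le> card P * (card X + 1)"
  proof -
    define q where "q = card P - card X"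
    have q: "card P = card X + q" using P by (simp add: q_def)
    have "2 * q \<le> q * (card X + 1)" using mult_le_mono2[of 2 "card X + 1" q] pos by simp
    moreover have "m \<le> q + card U" using window q by simp
    ultimately show ?thesis using U unfolding q add_mult_distrib by linarith
  qed
  also have "\<dots> \<le> card P * card L" using XL by (intro mult_le_mono2) simp
  finally show "F + 1 \<le> card P * card L" using assms by simp
qed

text \<open>The target F + 1 = 2m + t is paid in two parts: |K|^2 covers 2m, and a window of length
  t gives t <= q + |U|, where q counts the atoms outside K.\<close>

lemma wilf_depth_3:
  assumes F: "2 * m \<le> F" "F < 3 * m"
    and k: "2 * m \<le> (card (S \<inter> {m<..<2 * m}))\<^sup>2"
  shows "satisfies_wilf S"
proof (rule wilfI)
  define t where "t = F + 1 - 2 * m"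
  have t: "F + 1 = 2 * m + t" "t \<le> m" using F by (auto simp: t_def)
  define K where "K = S \<inter> {m..<2 * m}"
  define X where "X = S \<inter> {m..<m + t}"
  \<comment> \<open>Removing m + X makes K, B and m + X disjoint, so each counts separately in
    L.\<close>
  define B where "B = S \<inter> {2 * m..<F} - (+) m ` X"
  \<comment> \<open>This window starts at F + 1. Its length t forces the smaller summand below m +
    t, hence into X.\<close>
  let ?W = "{2 * m + t..<2 * m + 2 * t}"
  \<comment> \<open>The second part, 2m + X, costs only |X| and catches the sums from which m can be
    split off twice.\<close>
  define U where "U = (\<lambda>(x, y). x + y) ` (X \<times> (K \<union> B)) \<union> (\<lambda>x. m + (m + x)) ` X"
  have fin: "finite K" "finite X" "finite B" by (auto simp: K_def X_def B_def)
  then have finU: "finite U" by (simp add: U_def)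
  have KB: "card (K \<union> B) = card K + card B"
    using fin by (intro card_Un_disjoint) (auto simp: K_def B_def)
  have XK: "card X \<le> card K"
    using fin t by (intro card_mono) (auto simp: X_def K_def)
  have "2 * m \<noteq> F" using mult_in[of 2] F_notin by auto
  then have mX: "m \<in> X" using F m_in t by (auto simp: X_def)

  have "?W - P \<subseteq> U"
  proof
    fix w assume w: "w \<in> ?W - P"
    then have "w \<in> S" "w \<notin> P" "w \<noteq> 0" using above_F t m_pos by auto
    then obtain x y where xy: "x \<in> S" "y \<in> S" "m \<le> x" "x \<le> y" "w = x + y"
      by (rule decompose)
    \<comment> \<open>Since t <= m, the window ends at F + t <= F + m. This serves both for y and
      for x + x' below.\<close>
    have small: "s < F" if "s \<in> S" "m + s \<le> w" for s
    proof -
      have "s \<noteq> F" using that F_notin by auto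
      moreover have "s \<le> F" using that w t by auto
      ultimately show ?thesis by simp
    qed
    have sums: "u + v \<in> U" if "u \<in> X" "v \<in> K \<union> B" for u v
      using that unfolding U_def by (intro UnI1 image_eqI[of _ _ "(u, v)"]) auto
    have x: "x \<in> X" using xy w by (auto simp: X_def)
    have y: "y < F" using small[of y] xy by simp
    show "w \<in> U"
    proof (cases "y \<in> (+) m ` X")
      case False
      then have "y \<in> K \<union> B" using xy y by (auto simp: K_def B_def)
      then show ?thesis using sums x xy by simp
    next
      \<comment> \<open>Moving the summand m from y to x avoids counting the pairs in X twice.\<close>
      case True
      then obtain x' where x': "x' \<in> X" "y = m + x'" by auto
      have w': "w = m + (x + x')" using xy x' by simp
      have S': "x + x' \<in> S" "2 * m \<le> x + x'"
        using x x' by (auto simp: X_def add_in)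
      have F': "x + x' < F" using small[OF S'(1)] w' by simp
      show ?thesis
      proof (cases "x + x' \<in> (+) m ` X")
        case True
        then show ?thesis using w' unfolding U_def by auto
      next
        case False
        then have "x + x' \<in> K \<union> B" using S' F' by (simp add: B_def)
        then show ?thesis using sums[OF mX] w' by simp
      qed
    qed
  qed
  moreover have KP: "K \<subseteq> P" using first_interval_atoms by (simp add: K_def)
  moreover have "K \<inter> ?W = {}" by (auto simp: K_def)
  ultimately have window: "card K + t \<le> card P + card U"
    using card_window_atoms[of ?W U K] finU by simp

  have U: "card U \<le> card X * (card K + card B) + card X"
  proof -
    have "card U \<le> card ((\<lambda>(x, y). x + y) ` (X \<times> (K \<union> B))) + card ((\<lambda>x. m + (m + x)) ` X)"
      unfolding U_def by (rule card_Un_le)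
    also have "\<dots> \<le> card (X \<times> (K \<union> B)) + card X"
      using fin by (intro add_mono card_image_le) auto
    finally show ?thesis by (simp add: card_cartesian_product KB)
  qed

  have L: "1 + card K + card X + card B \<le> card L"
  proof -
    have "m + x < F" if "x \<in> X" for x
    proof -
      \<comment> \<open>By size, m + x can reach F = 2m + t - 1, but F is not in S.\<close>
      have "m + x \<noteq> F" using that F_notin m_in by (auto simp: X_def dest: add_in)
      then show ?thesis using that t by (auto simp: X_def)
    qed
    then have "insert 0 (K \<union> B \<union> (+) m ` X) \<subseteq> L"
      using zero_in F_pos F by (auto simp: K_def B_def X_def L_def add_in m_in)
    from card_mono[OF finite_L this]
    have "card (insert 0 (K \<union> B \<union> (+) m ` X)) \<le> card L" .
    moreover have "0 \<notin> K \<union> B \<union> (+) m ` X" using m_pos by (auto simp: K_def B_def)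
    moreover have "card (K \<union> B \<union> (+) m ` X) = card (K \<union> B) + card ((+) m ` X)"
      using fin by (intro card_Un_disjoint) (auto simp: K_def B_def X_def)
    moreover have "card ((+) m ` X) = card X" by (simp add: card_image)
    ultimately show ?thesis using fin KB by simp
  qed

  have K2: "2 * m \<le> card K * card K"
    using k card_first_interval unfolding K_def by (simp add: power2_eq_square)
  define q where "q = card P - card K"
  have q: "card P = card K + q" using card_mono[OF finite_P KP] by (simp add: q_def)
  have "t \<le> q + card U" using window q by simp
  \<comment> \<open>On the right, |K|^2 pays for 2m, and |K| |X| + |K| |B| + |K| pays for U because
    |X| <= |K|.\<close>
  moreover have "2 * m + card U \<le> card K * (1 + card K + card X + card B)"
    using U K2 XK mult_le_mono1[OF XK, of "card B"]
    unfolding add_mult_distrib2 mult.commute[of "card X" "card K"] mult.commute[of "card K" "card B"]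
      mult.commute[of "card X" "card B"]
    by linarith
  moreover have "q \<le> q * (1 + card K + card X + card B)" by simp
  ultimately have "F + 1 \<le> card P * (1 + card K + card X + card B)"
    unfolding t(1) q add_mult_distrib by linarith
  also have "\<dots> \<le> card P * card L" using L by (intro mult_le_mono2)
  finally show "F + 1 \<le> card P * card L" .
qed

section \<open>From the depth to bounds on F\<close>

lemma depth_bounds:
  "(semigroup_depth S - 1) * int m \<le> int F" "int F < semigroup_depth S * int m"
proof -
  let ?d = "semigroup_depth S"
  have d: "?d = \<lceil>(real F + 1) / real m\<rceil>"
    unfolding semigroup_depth_def m_def[symmetric] frobenius_number_def F_def
    using proper by simp
  have "real_of_int ?d - 1 < (real F + 1) / real m" "(real F + 1) / real m \<le> real_of_int ?d"
    unfolding d by linarith+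
  then have "(real_of_int ?d - 1) * real m < real F + 1" "real F + 1 \<le> real_of_int ?d * real m"
    using m_pos by (simp_all add: field_simps)
  \<comment> \<open>Both sides are integers, so the strict bound by F + 1 becomes a weak bound by
    F.\<close>
  then have "real_of_int ((?d - 1) * int m) < real_of_int (int F + 1)"
    "real_of_int (int F + 1) \<le> real_of_int (?d * int m)"
    by simp_all
  then show "(?d - 1) * int m \<le> int F" "int F < ?d * int m"
    unfolding of_int_less_iff of_int_le_iff by linarith+
qed

lemma depth_pos: "1 \<le> semigroup_depth S"
proof (rule ccontr)
  assume "\<not> ?thesis"
  then have "semigroup_depth S * int m \<le> 0" by (simp add: mult_nonpos_nonneg)
  then show False using depth_bounds by linarith
qed

text \<open>This is the first bound with its root and denominator cleared, in which form the second
  bound can also be reduced to it.\<close>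

lemma wilf_large_depth:
  assumes "3 \<le> semigroup_depth S"
    and "semigroup_depth S * int m
      \<le> (semigroup_depth S - 2) * (int (card (S \<inter> {m<..<2 * m})))\<^sup>2"
  shows "satisfies_wilf S"
proof -
  define n where "n = nat (semigroup_depth S - 2)"
  have d: "semigroup_depth S = int n + 2" using assms(1) by (simp add: n_def)
  have "int ((n + 1) * m) \<le> int F" "int F < int ((n + 2) * m)"
    using depth_bounds unfolding d by (simp_all add: algebra_simps)
  moreover have "int ((n + 2) * m) \<le> int (n * (card (S \<inter> {m<..<2 * m}))\<^sup>2)"
    using assms(2) unfolding d by (simp add: algebra_simps)
  ultimately show ?thesis
    unfolding of_nat_le_iff of_nat_less_iff by (rule wilf_from_first_interval)
qed

end

text \<open>The convention F = -1 makes the required bound 0. The locale excludes this case, where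
  the set of gaps has no maximum.\<close>

lemma wilf_UNIV: "satisfies_wilf UNIV"
  by (simp add: satisfies_wilf_def frobenius_number_def)

theorem theorem1p5:
  fixes S :: "nat set" and m :: nat and d :: int
  assumes "numerical_semigroup S"
    and "m = semigroup_multiplicity S"
    and "d = semigroup_depth S"
  shows "(d \<notin> {1, 2} \<and>
            real (card (S \<inter> {m<..<2 * m})) \<ge> sqrt (real_of_int d * real m / (real_of_int d - 2))
          \<longrightarrow> satisfies_wilf S)
       \<and> (real (card (S \<inter> {m<..<2 * m})) \<ge> sqrt (2 * real m) \<longrightarrow> satisfies_wilf S)"
proof (cases "S = UNIV")
  case True
  then show ?thesis using wilf_UNIV by simp
next
  case False
  interpret proper_numerical_semigroup S m "Max (UNIV - S)"
    using assms False by unfold_locales simp_all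
  let ?F = "Max (UNIV - S)"
  let ?k = "card (S \<inter> {m<..<2 * m})"
  show ?thesis
  proof (intro conjI impI)
    assume a: "d \<notin> {1, 2} \<and> sqrt (real_of_int d * real m / (real_of_int d - 2)) \<le> real ?k"
    \<comment> \<open>A semigroup with a gap has positive depth, so d - 2 is positive and may be
      multiplied out.\<close>
    then have d: "3 \<le> d" using depth_pos assms(3) by auto
    have "real_of_int d * real m / (real_of_int d - 2) \<le> (real ?k)\<^sup>2"
      using a by (intro sqrt_le_D) simp
    then have "real_of_int d * real m \<le> (real_of_int d - 2) * (real ?k)\<^sup>2"
      using d by (simp add: field_simps)
    then have "real_of_int (d * int m) \<le> real_of_int ((d - 2) * (int ?k)\<^sup>2)" by simp
    then have "d * int m \<le> (d - 2) * (int ?k)\<^sup>2" by (simp only: of_int_le_iff)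
    then show "satisfies_wilf S" using d wilf_large_depth assms(3) by simp
  next
    assume "sqrt (2 * real m) \<le> real ?k"
    then have "2 * real m \<le> (real ?k)\<^sup>2" by (rule sqrt_le_D)
    then have "real (2 * m) \<le> real (?k\<^sup>2)" by simp
    then have k: "2 * m \<le> ?k\<^sup>2" by (simp only: of_nat_le_iff)
    have bounds: "(d - 1) * int m \<le> int ?F" "int ?F < d * int m"
      using depth_bounds assms(3) by simp_all
    consider "d = 1" | "d = 2" | "d = 3" | "4 \<le> d"
      using depth_pos assms(3) by linarith
    then show "satisfies_wilf S"
    proof cases
      case 1
      then show ?thesis using bounds by (intro wilf_depth_1) simp
    next
      case 2
      then show ?thesis using bounds by (intro wilf_depth_2) simp_all
    next
      case 3
      then show ?thesis using bounds k by (intro wilf_depth_3) simp_all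
    next
      case 4
      \<comment> \<open>For d >= 4 one has d <= 2 (d - 2), so k^2 >= 2m implies the first
        bound.\<close>
      have "d * int m \<le> ((d - 2) * 2) * int m" using 4 by (intro mult_right_mono) auto
      also have "\<dots> = (d - 2) * int (2 * m)" by simp
      also have "\<dots> \<le> (d - 2) * int (?k\<^sup>2)"
        using 4 k by (intro mult_left_mono) (simp_all only: of_nat_le_iff)
      finally show ?thesis using 4 wilf_large_depth assms(3) by simp
    qed
  qed
qed

end
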